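(* Let $p$ be a prime and let $G$ be a pro-$p$ group admitting a branch pro-$p$ quotient, i.e. such that there exist a spherically homogeneous rooted tree $T$, a closed subgroup $H\le \mathrm{Aut}\,T$ which is a branch group and a pro-$p$ group, and a continuous surjective group homomorphism $G\to H$. Let $\mu$ be the normalized Haar measure on $G$ and let $F\subseteq G$ be the set of torsion elements of $G$, i.e. the set of elements of finite order. Then $$\mu(F)=0.$$
   Context: A spherically homogeneous rooted tree $T$ is an infinite tree with a distinguished root $\emptyset$ in which all vertices at the same distance from the root have the same number of immediate descendants; this number is finite and at least $2$ at every level. For $n\ge 0$, $\mathcal{L}_n$ denotes the (finite) set of vertices at distance exactly $n$ from the root. For a vertex $v$, $T_v$ denotes the subtree rooted at $v$, consisting of $v$ and all its descendants. $\mathrm{Aut}\,T$ is the group of graph automorphisms of $T$ fixing the root. It is a profinite group with respect to the congruence topology, in which the subgroups $\mathrm{St}(n)=\{g\in \mathrm{Aut}\,T : g(v)=v \text{ for all } v\in\mathcal{L}_n\}$, $n\ge 1$, form a basis of open neighbourhoods of the identity; subgroups carry the subspace topology. For $H\le \mathrm{Aut}\,T$ and a vertex $v$, the rigid vertex stabilizer $\mathrm{rist}_H(v)$ is the subgroup of all elements of $H$ which fix $v$ and fix every vertex not in $T_v$. For $n\ge 1$, the $n$th rigid level stabilizer is the (internal direct) product $\mathrm{RiSt}_H(n)=\prod_{v\in\mathcal{L}_n}\mathrm{rist}_H(v)\le H$. The group $H$ is level-transitive if it acts transitively on $\mathcal{L}_n$ for all $n\ge 1$. The group $H$ is branch if it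 is level-transitive and $\mathrm{RiSt}_H(n)$ has finite index in $H$ for every $n\ge 1$. A pro-$p$ group is a topological group isomorphic to an inverse limit of finite $p$-groups. The normalized Haar measure on a compact group $G$ is the unique left-invariant regular Borel probability measure on $G$. *)

theory Defs
  imports
    "HOL-Algebra.Bij"
    "HOL-Algebra.Coset"
    "HOL-Algebra.Generated_Groups"
    "HOL-Algebra.Product_Groups"
    "HOL-Probability.Probability_Measure"
begin

section \<open>Rooted trees\<close>

record 'v rooted_graph =
  rt_verts :: "'v set"
  rt_adj :: "'v \<Rightarrow> 'v \<Rightarrow> bool"
  rt_root :: 'v

definition simple_path :: "'v rooted_graph \<Rightarrow> 'v \<Rightarrow> 'v list \<Rightarrow> 'v \<Rightarrow> bool" where
  "simple_path T u xs v \<longleftrightarrow>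
     xs \<noteq> [] \<and> hd xs = u \<and> last xs = v \<and> set xs \<subseteq> rt_verts T \<and>
     distinct xs \<and> successively (rt_adj T) xs"

definition rooted_tree :: "'v rooted_graph \<Rightarrow> bool" where
  "rooted_tree T \<longleftrightarrow>
     rt_root T \<in> rt_verts T \<and>
     (\<forall>u v. rt_adj T u v \<longrightarrow> u \<in> rt_verts T \<and> v \<in> rt_verts T \<and> u \<noteq> v \<and> rt_adj T v u) \<and>
     (\<forall>u\<in>rt_verts T. \<forall>v\<in>rt_verts T. \<exists>!xs. simple_path T u xs v)"

text \<open>A path on \<open>n + 1\<close> vertices has length \<open>n\<close>.\<close>

definition graph_dist :: "'v rooted_graph \<Rightarrow> 'v \<Rightarrow> 'v \<Rightarrow> nat" where
  "graph_dist T u v = (LEAST n. \<exists>xs. simple_path T u xs v \<and> length xs = Suc n)"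

definition level :: "'v rooted_graph \<Rightarrow> nat \<Rightarrow> 'v set" where
  "level T n = {v \<in> rt_verts T. graph_dist T (rt_root T) v = n}"

definition is_child :: "'v rooted_graph \<Rightarrow> 'v \<Rightarrow> 'v \<Rightarrow> bool" where
  "is_child T v w \<longleftrightarrow>
     rt_adj T v w \<and> graph_dist T (rt_root T) w = Suc (graph_dist T (rt_root T) v)"

definition children :: "'v rooted_graph \<Rightarrow> 'v \<Rightarrow> 'v set" where
  "children T v = {w. is_child T v w}"

definition subtree_verts :: "'v rooted_graph \<Rightarrow> 'v \<Rightarrow> 'v set" where
  "subtree_verts T v = {w. (is_child T)\<^sup>*\<^sup>* v w}"

definition spherically_homogeneous_tree :: "'v rooted_graph \<Rightarrow> bool" where
  "spherically_homogeneous_tree T \<longleftrightarrow>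
     rooted_tree T \<and> infinite (rt_verts T) \<and>
     (\<forall>n. \<forall>u\<in>level T n. \<forall>v\<in>level T n. card (children T u) = card (children T v)) \<and>
     (\<forall>v\<in>rt_verts T. finite (children T v) \<and> card (children T v) \<ge> 2)"


section \<open>Automorphism groups of rooted trees\<close>

text \<open>As in \<^const>\<open>BijGroup\<close>, automorphisms are extensional functions on the vertex set, so that
  equality in the group is equality of vertex maps.\<close>

definition Aut_tree :: "'v rooted_graph \<Rightarrow> ('v \<Rightarrow> 'v) monoid" where
  "Aut_tree T = (BijGroup (rt_verts T))\<lparr>carrier :=
     {g \<in> Bij (rt_verts T). g (rt_root T) = rt_root T \<and>
        (\<forall>u\<in>rt_verts T. \<forall>v\<in>rt_verts T. rt_adj T (g u) (g v) \<longleftrightarrow> rt_adj T u v)}\<rparr>"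

definition level_stabilizer :: "'v rooted_graph \<Rightarrow> nat \<Rightarrow> ('v \<Rightarrow> 'v) set" where
  "level_stabilizer T n = {g \<in> carrier (Aut_tree T). \<forall>v\<in>level T n. g v = v}"

text \<open>The level stabilizers are nested, so their cosets are a base and not just a subbase.\<close>

definition congruence_topology :: "'v rooted_graph \<Rightarrow> ('v \<Rightarrow> 'v) topology" where
  "congruence_topology T = topology_generated_by
     {g <#\<^bsub>Aut_tree T\<^esub> level_stabilizer T n | g n. g \<in> carrier (Aut_tree T) \<and> n \<ge> 1}"

definition rist :: "'v rooted_graph \<Rightarrow> ('v \<Rightarrow> 'v) set \<Rightarrow> 'v \<Rightarrow> ('v \<Rightarrow> 'v) set" where
  "rist T H v = {h \<in> H. h v = v \<and> (\<forall>u \<in> rt_verts T - subtree_verts T v. h u = u)}"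

text \<open>The subgroups \<open>rist T H v\<close> for \<open>v\<close> on a fixed level commute elementwise and are
  independent (their supports are disjoint), and a level is finite; hence their internal direct
  product is the subgroup they generate.\<close>

definition RiSt :: "'v rooted_graph \<Rightarrow> ('v \<Rightarrow> 'v) set \<Rightarrow> nat \<Rightarrow> ('v \<Rightarrow> 'v) set" where
  "RiSt T H n = generate (Aut_tree T) (\<Union>v\<in>level T n. rist T H v)"

definition level_transitive :: "'v rooted_graph \<Rightarrow> ('v \<Rightarrow> 'v) set \<Rightarrow> bool" where
  "level_transitive T H \<longleftrightarrow> (\<forall>n\<ge>1. \<forall>u\<in>level T n. \<forall>v\<in>level T n. \<exists>h\<in>H. h u = v)"

definition branch :: "'v rooted_graph \<Rightarrow> ('v \<Rightarrow> 'v) set \<Rightarrow> bool" where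
  "branch T H \<longleftrightarrow>
     subgroup H (Aut_tree T) \<and> level_transitive T H \<and>
     (\<forall>n\<ge>1. finite (rcosets\<^bsub>(Aut_tree T)\<lparr>carrier := H\<rparr>\<^esub> (RiSt T H n)))"


section \<open>Topological groups and pro-p groups\<close>

definition topological_group :: "('a, 'm) monoid_scheme \<Rightarrow> 'a topology \<Rightarrow> bool" where
  "topological_group G X \<longleftrightarrow>
     group G \<and> topspace X = carrier G \<and>
     continuous_map (prod_topology X X) X (\<lambda>(x, y). x \<otimes>\<^bsub>G\<^esub> y) \<and>
     continuous_map X X (\<lambda>x. inv\<^bsub>G\<^esub> x)"

definition finite_p_group :: "nat \<Rightarrow> ('b, 'm) monoid_scheme \<Rightarrow> bool" where
  "finite_p_group p K \<longleftrightarrow> group K \<and> finite (carrier K) \<and> (\<exists>k. card (carrier K) = p ^ k)"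

text \<open>For \<open>rel i j\<close> the transition map \<open>f i j\<close> goes from \<open>K j\<close> to \<open>K i\<close>.\<close>

definition inverse_system ::
  "'i set \<Rightarrow> ('i \<Rightarrow> 'i \<Rightarrow> bool) \<Rightarrow> ('i \<Rightarrow> 'b monoid) \<Rightarrow> ('i \<Rightarrow> 'i \<Rightarrow> 'b \<Rightarrow> 'b) \<Rightarrow> bool" where
  "inverse_system I rel K f \<longleftrightarrow>
     I \<noteq> {} \<and>
     (\<forall>i\<in>I. rel i i) \<and>
     (\<forall>i\<in>I. \<forall>j\<in>I. \<forall>k\<in>I. rel i j \<longrightarrow> rel j k \<longrightarrow> rel i k) \<and>
     (\<forall>i\<in>I. \<forall>j\<in>I. \<exists>k\<in>I. rel i k \<and> rel j k) \<and>
     (\<forall>i\<in>I. group (K i)) \<and>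
     (\<forall>i\<in>I. \<forall>j\<in>I. rel i j \<longrightarrow> f i j \<in> hom (K j) (K i)) \<and>
     (\<forall>i\<in>I. \<forall>x\<in>carrier (K i). f i i x = x) \<and>
     (\<forall>i\<in>I. \<forall>j\<in>I. \<forall>k\<in>I. rel i j \<longrightarrow> rel j k \<longrightarrow>
        (\<forall>x\<in>carrier (K k). f i j (f j k x) = f i k x))"

definition inverse_limit ::
  "'i set \<Rightarrow> ('i \<Rightarrow> 'i \<Rightarrow> bool) \<Rightarrow> ('i \<Rightarrow> 'b monoid) \<Rightarrow> ('i \<Rightarrow> 'i \<Rightarrow> 'b \<Rightarrow> 'b) \<Rightarrow> ('i \<Rightarrow> 'b) monoid" where
  "inverse_limit I rel K f = (product_group I K)\<lparr>carrier :=
     {x \<in> carrier (product_group I K). \<forall>i\<in>I. \<forall>j\<in>I. rel i j \<longrightarrow> f i j (x j) = x i}\<rparr>"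

definition inverse_limit_topology ::
  "'i set \<Rightarrow> ('i \<Rightarrow> 'i \<Rightarrow> bool) \<Rightarrow> ('i \<Rightarrow> 'b monoid) \<Rightarrow> ('i \<Rightarrow> 'i \<Rightarrow> 'b \<Rightarrow> 'b) \<Rightarrow> ('i \<Rightarrow> 'b) topology" where
  "inverse_limit_topology I rel K f =
     subtopology (product_topology (\<lambda>i. discrete_topology (carrier (K i))) I)
       (carrier (inverse_limit I rel K f))"

text \<open>HOL cannot quantify over types inside a formula, so the types of the index set and of the
  finite groups are parameters. A theorem that assumes \<open>pro_p_group\<close> with type variables here
  covers every inverse system.\<close>

definition pro_p_group ::
  "('i \<times> 'b) itself \<Rightarrow> nat \<Rightarrow> ('a, 'm) monoid_scheme \<Rightarrow> 'a topology \<Rightarrow> bool" where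
  "pro_p_group ty p G X \<longleftrightarrow>
     topological_group G X \<and>
     (\<exists>(I :: 'i set) rel (K :: 'i \<Rightarrow> 'b monoid) f.
        inverse_system I rel K f \<and>
        (\<forall>i\<in>I. finite_p_group p (K i)) \<and>
        (\<exists>\<psi> \<in> iso G (inverse_limit I rel K f).
           homeomorphic_map X (inverse_limit_topology I rel K f) \<psi>))"


section \<open>Haar measure and torsion elements\<close>

definition normalized_haar_measure ::
  "('a, 'm) monoid_scheme \<Rightarrow> 'a topology \<Rightarrow> 'a measure \<Rightarrow> bool" where
  "normalized_haar_measure G X \<mu> \<longleftrightarrow>
     prob_space \<mu> \<and>
     space \<mu> = topspace X \<and>
     sets \<mu> = sigma_sets (topspace X) {U. openin X U} \<and>
     (\<forall>g\<in>carrier G. \<forall>A\<in>sets \<mu>. emeasure \<mu> (g <#\<^bsub>G\<^esub> A) = emeasure \<mu> A) \<and>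
     (\<forall>A\<in>sets \<mu>. emeasure \<mu> A = (INF U\<in>{U. openin X U \<and> A \<subseteq> U}. emeasure \<mu> U)) \<and>
     (\<forall>A\<in>sets \<mu>. emeasure \<mu> A = (SUP K\<in>{K. compactin X K \<and> K \<subseteq> A}. emeasure \<mu> K))"

definition torsion_elements :: "('a, 'm) monoid_scheme \<Rightarrow> 'a set" where
  "torsion_elements G = {g \<in> carrier G. \<exists>n::nat. n > 0 \<and> g [^]\<^bsub>G\<^esub> n = \<one>\<^bsub>G\<^esub>}"

end

theory Submission
  imports Defs
begin

text \<open>
  For a vertex \<open>w\<close> and \<open>q > 0\<close> consider the automorphisms \<open>h\<close> for which the orbit of \<open>w\<close> has length \<open>q\<close>
  and \<open>h\<close> to the power \<open>q\<close> is the identity on the subtree below \<open>w\<close> (\<open>trivial_return q w\<close>). Two facts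
  about these sets give the theorem.

  First, each torsion element lies in one of them (\<open>torsion_has_trivial_return\<close>): its orbits have
  bounded length, so some vertex \<open>w\<close> has an orbit of maximal length, and then all descendants of \<open>w\<close> have
  orbits of that same length. As the tree has only countably many vertices, it suffices that the
  preimage \<open>E\<close> in \<open>G\<close> of each \<open>trivial_return q w\<close> has measure 0.

  Second, left translation by an element \<open>r\<close> of the rigid stabilizer of \<open>w\<close> changes the return
  map at \<open>w\<close> by exactly \<open>r\<close>, so a nontrivial \<open>r\<close> translates \<open>trivial_return q w\<close> off itself
  (\<open>rist_translate_trivial_return\<close>). In a branch group the rigid stabilizer of every vertex is infinite
  (\<open>branch_rist_infinite\<close>). Lifting its elements to \<open>G\<close> gives infinitely many pairwise disjoint left
  translates of \<open>E\<close>. They all have the same Haar measure, and the total measure is finite, so \<open>E\<close> is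
  null (\<open>haar_null_if_disjoint_translates\<close>).
\<close>

section \<open>Paths, levels and subtrees of a rooted tree\<close>

locale rooted_tree_graph =
  fixes T :: "'v rooted_graph"
  assumes tree: "rooted_tree T"
begin

abbreviation "V \<equiv> rt_verts T"
abbreviation "depth v \<equiv> graph_dist T (rt_root T) v"

lemma root_path_ex:
  assumes "v \<in> V"
  obtains xs where "simple_path T (rt_root T) xs v"
  using tree assms unfolding rooted_tree_def by blast

lemma root_path_unique:
  assumes "simple_path T (rt_root T) xs v" and "simple_path T (rt_root T) ys v"
  shows "xs = ys"
proof -
  have "v \<in> V"
    using assms(1) unfolding simple_path_def by (metis last_in_set subsetD)
  then show ?thesis
    using tree assms unfolding rooted_tree_def by blast
qed

lemma length_root_path:
  assumes "simple_path T (rt_root T) xs v"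
  shows "length xs = Suc (depth v)"
proof -
  have "xs \<noteq> []"
    using assms unfolding simple_path_def by simp
  then have "length xs = Suc (length xs - 1)"
    by simp
  moreover have "depth v = length xs - 1"
    unfolding graph_dist_def
  proof (rule Least_equality)
    show "\<exists>ys. simple_path T (rt_root T) ys v \<and> length ys = Suc (length xs - 1)"
      using assms calculation by blast
  next
    fix n
    assume "\<exists>ys. simple_path T (rt_root T) ys v \<and> length ys = Suc n"
    then show "length xs - 1 \<le> n"
      using root_path_unique[OF assms] by auto
  qed
  ultimately show ?thesis
    by simp
qed

lemma simple_path_prefix:
  assumes "simple_path T u (xs @ ys) v" and "xs \<noteq> []"
  shows "simple_path T u xs (last xs)"
  using assms unfolding simple_path_def by (auto simp: successively_append_iff)

lemma adj_verts:
  assumes "rt_adj T u v"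
  shows "u \<in> V" and "v \<in> V"
  using tree assms unfolding rooted_tree_def by blast+

lemma child_verts:
  assumes "is_child T v u"
  shows "v \<in> V" and "u \<in> V"
  using adj_verts assms unfolding is_child_def by blast+

lemma child_depth: "is_child T v u \<Longrightarrow> depth u = Suc (depth v)"
  unfolding is_child_def by simp

text \<open>Appending a child to the root path of its parent keeps the path simple: a repeated vertex would
  give the child a root path no longer than that of its parent. Parents are therefore unique.\<close>

lemma root_path_snoc:
  assumes "is_child T v u" and xs: "simple_path T (rt_root T) xs v"
  shows "simple_path T (rt_root T) (xs @ [u]) u"
proof -
  have "u \<notin> set xs"
  proof
    assume "u \<in> set xs"
    then obtain as bs where "xs = (as @ [u]) @ bs"
      by (metis append.assoc append_Cons append_Nil split_list)
    then have "simple_path T (rt_root T) (as @ [u]) u" and "length (as @ [u]) \<le> length xs"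
      using simple_path_prefix[of _ "as @ [u]" bs] xs by auto
    then show False
      using length_root_path xs child_depth[OF assms(1)] by fastforce
  qed
  then show ?thesis
    using xs assms(1) child_verts[OF assms(1)]
    unfolding simple_path_def is_child_def by (auto simp: successively_append_iff)
qed

lemma parent_unique:
  assumes "is_child T v u" and "is_child T v' u"
  shows "v = v'"
proof -
  obtain xs ys where xs: "simple_path T (rt_root T) xs v"
    and ys: "simple_path T (rt_root T) ys v'"
    using root_path_ex child_verts assms by metis
  have "xs = ys"
    using root_path_unique[OF root_path_snoc[OF assms(1) xs] root_path_snoc[OF assms(2) ys]] by simp
  then show ?thesis
    using xs ys unfolding simple_path_def by simp
qed

lemma depth_0_imp_root:
  assumes "v \<in> V" and "depth v = 0"
  shows "v = rt_root T"
proof -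
  obtain xs where xs: "simple_path T (rt_root T) xs v"
    using root_path_ex assms by blast
  then have "length xs = 1"
    using length_root_path assms by fastforce
  then show ?thesis
    using xs unfolding simple_path_def by (auto simp: length_Suc_conv)
qed

lemma parent_ex:
  assumes "u \<in> V" and "depth u = Suc n"
  obtains v where "v \<in> level T n" and "is_child T v u"
proof -
  obtain xs where xs: "simple_path T (rt_root T) xs u"
    using root_path_ex assms by blast
  define ys where "ys = butlast xs"
  have len: "length xs = Suc (Suc n)"
    using length_root_path[OF xs] assms by simp
  have "xs \<noteq> []"
    using len by auto
  moreover have "last xs = u"
    using xs unfolding simple_path_def by simp
  ultimately have xs_eq: "xs = ys @ [u]"
    unfolding ys_def by (metis append_butlast_last_id)
  have ne: "ys \<noteq> []"
    using len xs_eq by auto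
  have ys: "simple_path T (rt_root T) ys (last ys)"
    using simple_path_prefix[OF _ ne] xs xs_eq by blast
  have d: "depth (last ys) = n"
    using length_root_path[OF ys] len xs_eq by simp
  have "rt_adj T (last ys) u"
    using xs ne unfolding xs_eq simple_path_def by (auto simp: successively_append_iff)
  then show thesis
    using that[of "last ys"] d assms(2) adj_verts unfolding level_def is_child_def by auto
qed

lemma subtree_refl: "v \<in> subtree_verts T v"
  unfolding subtree_verts_def by simp

lemma subtree_trans:
  "u \<in> subtree_verts T v \<Longrightarrow> subtree_verts T u \<subseteq> subtree_verts T v"
  unfolding subtree_verts_def by auto

lemma subtree_step:
  "is_child T v u \<Longrightarrow> u \<in> subtree_verts T v"
  unfolding subtree_verts_def by auto

lemma subtree_in_verts:
  assumes "x \<in> subtree_verts T v" and "v \<in> V"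
  shows "x \<in> V"
  using assms unfolding subtree_verts_def mem_Collect_eq
  by (induction rule: rtranclp_induct) (auto dest: child_verts)

lemma subtree_depth:
  assumes "x \<in> subtree_verts T v"
  shows "depth v \<le> depth x"
  using assms unfolding subtree_verts_def mem_Collect_eq
  by (induction rule: rtranclp_induct) (auto dest: child_depth)

lemma subtree_same_depth:
  assumes "x \<in> subtree_verts T v" and "depth x = depth v"
  shows "x = v"
  using assms(1) unfolding subtree_verts_def mem_Collect_eq
proof (cases rule: rtranclp.cases)
  case (rtrancl_into_rtrancl y)
  then have "depth v \<le> depth y" "depth x = Suc (depth y)"
    using subtree_depth child_depth unfolding subtree_verts_def by auto
  then show ?thesis
    using assms(2) by simp
qed simp

text \<open>All later disjointness of supports comes from this: an automorphism that moves \<open>w\<close> moves the whole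
  subtree below \<open>w\<close> off itself.\<close>

lemma subtrees_disjoint:
  assumes "x \<in> subtree_verts T v" and "x \<in> subtree_verts T w" and "depth v = depth w"
  shows "v = w"
  using assms(1,2) unfolding subtree_verts_def mem_Collect_eq
proof (induction rule: rtranclp_induct)
  case base
  then show ?case
    using subtree_same_depth assms(3) unfolding subtree_verts_def by auto
next
  case (step y z)
  from \<open>(is_child T)\<^sup>*\<^sup>* w z\<close> show ?case
  proof (cases rule: rtranclp.cases)
    case rtrancl_refl
    then have "depth v = Suc (depth y)"
      using step.hyps(2) child_depth assms(3) by simp
    then show ?thesis
      using subtree_depth[of y v] step.hyps(1) unfolding subtree_verts_def by simp
  next
    case (rtrancl_into_rtrancl y')
    then show ?thesis
      using parent_unique[OF step.hyps(2)] step.IH by metis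
  qed
qed

lemma countable_verts:
  assumes "\<And>v. v \<in> V \<Longrightarrow> finite (children T v)"
  shows "countable V"
proof -
  have "countable (level T n)" for n
  proof (induction n)
    case 0
    have "level T 0 \<subseteq> {rt_root T}"
      using depth_0_imp_root unfolding level_def by blast
    then show ?case
      by (meson countable_finite finite.emptyI finite_insert finite_subset)
  next
    case (Suc n)
    have "level T (Suc n) \<subseteq> (\<Union>v\<in>level T n. children T v)"
    proof
      fix u
      assume "u \<in> level T (Suc n)"
      then show "u \<in> (\<Union>v\<in>level T n. children T v)"
        using parent_ex[of u n] unfolding level_def children_def by blast
    qed
    moreover have "countable (children T v)" if "v \<in> level T n" for v
      using assms that unfolding level_def by (simp add: countable_finite)
    ultimately show ?case
      using Suc countable_UN countable_subset by metis
  qed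
  then have "countable (\<Union>n. level T n)"
    by simp
  moreover have "V = (\<Union>n. level T n)"
    unfolding level_def by auto
  ultimately show ?thesis
    by simp
qed

lemma deep_descendant:
  assumes "\<And>v. v \<in> V \<Longrightarrow> children T v \<noteq> {}" and "w \<in> V"
  shows "\<exists>u\<in>subtree_verts T w. n \<le> depth u"
proof (induction n)
  case 0
  then show ?case
    using subtree_refl by blast
next
  case (Suc n)
  then obtain u where u: "u \<in> subtree_verts T w" "n \<le> depth u"
    by blast
  then obtain c where c: "is_child T u c"
    using assms subtree_in_verts unfolding children_def by blast
  then have "c \<in> subtree_verts T w"
    using u subtree_trans subtree_step by blast
  then show ?case
    using u child_depth[OF c] by force
qed


section \<open>Automorphisms of a rooted tree\<close>

lemma Aut_tree_iff:
  "g \<in> carrier (Aut_tree T) \<longleftrightarrow> g \<in> Bij V \<and> g (rt_root T) = rt_root T \<and>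
     (\<forall>u\<in>V. \<forall>v\<in>V. rt_adj T (g u) (g v) \<longleftrightarrow> rt_adj T u v)"
  unfolding Aut_tree_def by simp

lemma Aut_in_verts:
  assumes "g \<in> carrier (Aut_tree T)" and "x \<in> V"
  shows "g x \<in> V"
  using assms Bij_imp_funcset unfolding Aut_tree_iff by blast

lemma Aut_inj_on: "g \<in> carrier (Aut_tree T) \<Longrightarrow> inj_on g V"
  unfolding Aut_tree_iff Bij_def bij_betw_def by blast

lemma Aut_mult_apply:
  assumes "g \<in> carrier (Aut_tree T)" and "h \<in> carrier (Aut_tree T)" and "x \<in> V"
  shows "(g \<otimes>\<^bsub>Aut_tree T\<^esub> h) x = g (h x)"
  using assms unfolding Aut_tree_iff by (simp add: Aut_tree_def BijGroup_def compose_def)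

lemma Aut_one_apply: "x \<in> V \<Longrightarrow> \<one>\<^bsub>Aut_tree T\<^esub> x = x"
  by (simp add: Aut_tree_def BijGroup_def)

lemma Aut_eqI:
  assumes "g \<in> carrier (Aut_tree T)" and "h \<in> carrier (Aut_tree T)"
    and "\<And>x. x \<in> V \<Longrightarrow> g x = h x"
  shows "g = h"
  using assms extensionalityI[of g V h] unfolding Aut_tree_iff Bij_def by blast

lemma group_Aut_tree: "group (Aut_tree T)"
proof -
  let ?A = "carrier (Aut_tree T)"
  have root: "rt_root T \<in> V"
    using tree unfolding rooted_tree_def by blast
  interpret B: group "BijGroup V"
    by (rule group_BijGroup)
  have "subgroup ?A (BijGroup V)"
  proof
    show "?A \<subseteq> carrier (BijGroup V)"
      unfolding Aut_tree_def BijGroup_def by auto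
  next
    fix g h
    assume g: "g \<in> ?A" and h: "h \<in> ?A"
    have "g \<otimes>\<^bsub>BijGroup V\<^esub> h = compose V g h"
      using g h unfolding Aut_tree_iff BijGroup_def by simp
    then show "g \<otimes>\<^bsub>BijGroup V\<^esub> h \<in> ?A"
      using g h root Aut_in_verts[OF h] compose_Bij[of g V h]
      unfolding Aut_tree_iff by (simp add: compose_eq)
  next
    show "\<one>\<^bsub>BijGroup V\<^esub> \<in> ?A"
      using root unfolding Aut_tree_iff BijGroup_def by (simp add: id_Bij)
  next
    fix g
    assume g: "g \<in> ?A"
    then have bij: "g \<in> Bij V" and gV: "g ` V = V"
      unfolding Aut_tree_iff Bij_def bij_betw_def by blast+
    let ?i = "\<lambda>x\<in>V. inv_into V g x"
    have "?i (rt_root T) = rt_root T"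
      using g root inv_into_f_f[OF Aut_inj_on[OF g], of "rt_root T"] unfolding Aut_tree_iff by simp
    moreover have "rt_adj T (?i u) (?i v) \<longleftrightarrow> rt_adj T u v" if "u \<in> V" "v \<in> V" for u v
    proof -
      have "inv_into V g u \<in> V" "inv_into V g v \<in> V"
        "g (inv_into V g u) = u" "g (inv_into V g v) = v"
        using that gV by (simp_all add: inv_into_into f_inv_into_f)
      then show ?thesis
        using g that unfolding Aut_tree_iff by (metis restrict_apply')
    qed
    ultimately show "inv\<^bsub>BijGroup V\<^esub> g \<in> ?A"
      using bij unfolding inv_BijGroup[OF bij] Aut_tree_iff
      by (simp add: restrict_inv_into_Bij)
  qed
  then have "group ((BijGroup V)\<lparr>carrier := ?A\<rparr>)"
    by (rule subgroup.subgroup_is_group) (rule group_BijGroup)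
  then show ?thesis
    unfolding Aut_tree_def by simp
qed

lemma Aut_simple_path:
  assumes g: "g \<in> carrier (Aut_tree T)" and xs: "simple_path T u xs v"
  shows "simple_path T (g u) (map g xs) (g v)"
proof -
  have V: "set xs \<subseteq> V" and ne: "xs \<noteq> []" and succ: "successively (rt_adj T) xs"
    using xs unfolding simple_path_def by auto
  have "successively (\<lambda>x y. rt_adj T (g x) (g y)) xs"
    using succ by (rule successively_mono) (use g V in \<open>auto simp: Aut_tree_iff\<close>)
  moreover have "inj_on g (set xs)"
    using Aut_inj_on[OF g] V by (rule inj_on_subset)
  ultimately show ?thesis
    using xs V Aut_in_verts[OF g] ne unfolding simple_path_def
    by (auto simp: successively_map distinct_map hd_map last_map)
qed

lemma Aut_depth:
  assumes g: "g \<in> carrier (Aut_tree T)" and "x \<in> V"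
  shows "depth (g x) = depth x"
proof -
  obtain xs where xs: "simple_path T (rt_root T) xs x"
    using root_path_ex assms(2) by blast
  have "simple_path T (rt_root T) (map g xs) (g x)"
    using Aut_simple_path[OF g xs] g unfolding Aut_tree_iff by simp
  then have "length (map g xs) = Suc (depth (g x))"
    by (rule length_root_path)
  then show ?thesis
    using length_root_path[OF xs] by simp
qed

lemma Aut_child:
  assumes g: "g \<in> carrier (Aut_tree T)" and "is_child T v u"
  shows "is_child T (g v) (g u)"
proof -
  have "v \<in> V" "u \<in> V"
    using child_verts assms(2) by auto
  then show ?thesis
    using assms Aut_depth[OF g] unfolding is_child_def Aut_tree_iff by simp
qed

lemma Aut_subtree:
  assumes g: "g \<in> carrier (Aut_tree T)" and "x \<in> subtree_verts T v"
  shows "g x \<in> subtree_verts T (g v)"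
  using assms(2) unfolding subtree_verts_def mem_Collect_eq
  by (induction rule: rtranclp_induct) (auto intro: rtranclp.rtrancl_into_rtrancl Aut_child[OF g])

lemma Aut_funpow:
  assumes g: "g \<in> carrier (Aut_tree T)"
  shows "x \<in> V \<Longrightarrow> (g ^^ n) x \<in> V"
    and "x \<in> V \<Longrightarrow> depth ((g ^^ n) x) = depth x"
    and "x \<in> subtree_verts T v \<Longrightarrow> (g ^^ n) x \<in> subtree_verts T ((g ^^ n) v)"
proof (induction n)
  case (Suc n)
  { case 1 then show ?case using Suc Aut_in_verts[OF g] by simp }
  { case 2 then show ?case using Suc Aut_depth[OF g] by simp }
  { case 3 then show ?case using Suc Aut_subtree[OF g] by simp }
qed simp_all

lemma Aut_pow_apply:
  assumes g: "g \<in> carrier (Aut_tree T)" and "x \<in> V"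
  shows "(g [^]\<^bsub>Aut_tree T\<^esub> (n::nat)) x = (g ^^ n) x"
proof -
  interpret A: group "Aut_tree T"
    by (rule group_Aut_tree)
  show ?thesis
    using assms(2)
  proof (induction n arbitrary: x)
    case 0
    then show ?case
      using Aut_one_apply by simp
  next
    case (Suc n)
    then show ?case
      using Aut_mult_apply[OF A.nat_pow_closed[OF g] g] Aut_in_verts[OF g]
      by (simp add: funpow_swap1)
  qed
qed


section \<open>Rigid vertex stabilizers\<close>

lemma rist_subgroup:
  assumes H: "subgroup H (Aut_tree T)" and w: "w \<in> V"
  shows "subgroup (rist T H w) (Aut_tree T)"
proof -
  interpret A: group "Aut_tree T"
    by (rule group_Aut_tree)
  interpret H: subgroup H "Aut_tree T"
    by (rule H)
  have fix_inv: "(inv\<^bsub>Aut_tree T\<^esub> h) u = u" if h: "h \<in> H" and u: "u \<in> V" "h u = u" for h u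
  proof -
    have "(inv\<^bsub>Aut_tree T\<^esub> h \<otimes>\<^bsub>Aut_tree T\<^esub> h) u = u"
      using h u by (simp add: Aut_one_apply)
    then show ?thesis
      using Aut_mult_apply[of "inv\<^bsub>Aut_tree T\<^esub> h" h u] h u by simp
  qed
  show ?thesis
  proof
    show "rist T H w \<subseteq> carrier (Aut_tree T)"
      using H.subset unfolding rist_def by auto
    show "\<one>\<^bsub>Aut_tree T\<^esub> \<in> rist T H w"
      using w unfolding rist_def by (simp add: Aut_one_apply)
    show "x \<otimes>\<^bsub>Aut_tree T\<^esub> y \<in> rist T H w" if "x \<in> rist T H w" "y \<in> rist T H w" for x y
      using that w unfolding rist_def by (simp add: Aut_mult_apply)
    show "inv\<^bsub>Aut_tree T\<^esub> x \<in> rist T H w" if "x \<in> rist T H w" for x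
      using that w fix_inv unfolding rist_def by simp
  qed
qed

lemma rist_conjugate:
  assumes H: "subgroup H (Aut_tree T)" and r: "r \<in> rist T H v" and h: "h \<in> H" and v: "v \<in> V"
  shows "h \<otimes>\<^bsub>Aut_tree T\<^esub> r \<otimes>\<^bsub>Aut_tree T\<^esub> inv\<^bsub>Aut_tree T\<^esub> h \<in> rist T H (h v)"
proof -
  interpret A: group "Aut_tree T"
    by (rule group_Aut_tree)
  interpret H: subgroup H "Aut_tree T"
    by (rule H)
  let ?i = "inv\<^bsub>Aut_tree T\<^esub> h"
  have rH: "r \<in> H"
    using r unfolding rist_def by simp
  have i: "?i \<in> carrier (Aut_tree T)"
    using h by simp
  have ih: "?i (h u) = u" if "u \<in> V" for u
    using h that Aut_mult_apply[of ?i h u] by (simp add: Aut_one_apply)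
  have hi: "h (?i u) = u" if "u \<in> V" for u
    using h that Aut_mult_apply[of h ?i u] by (simp add: Aut_one_apply)
  have app: "(h \<otimes>\<^bsub>Aut_tree T\<^esub> r \<otimes>\<^bsub>Aut_tree T\<^esub> ?i) u = h (r (?i u))" if "u \<in> V" for u
    using h rH that Aut_in_verts[OF i] by (simp add: Aut_mult_apply)
  have hv: "h v \<in> V"
    using h v Aut_in_verts by simp
  have "(h \<otimes>\<^bsub>Aut_tree T\<^esub> r \<otimes>\<^bsub>Aut_tree T\<^esub> ?i) u = u" if u: "u \<in> V" "u \<notin> subtree_verts T (h v)" for u
  proof -
    have "?i u \<notin> subtree_verts T v"
      using Aut_subtree[of h "?i u" v] h hi u by auto
    then have "r (?i u) = ?i u"
      using r Aut_in_verts[OF i] u unfolding rist_def by simp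
    then show ?thesis
      using app hi u by simp
  qed
  moreover have "(h \<otimes>\<^bsub>Aut_tree T\<^esub> r \<otimes>\<^bsub>Aut_tree T\<^esub> ?i) (h v) = h v"
    using app[OF hv] ih[OF v] r unfolding rist_def by simp
  ultimately show ?thesis
    using h rH unfolding rist_def by simp
qed

text \<open>An element supported strictly below \<open>w\<close> cannot move \<open>w\<close>, which lies outside the smaller subtree.\<close>

lemma rist_mono:
  assumes u: "u \<in> subtree_verts T w" and w: "w \<in> V"
  shows "rist T H u \<subseteq> rist T H w"
proof
  fix r
  assume r: "r \<in> rist T H u"
  have "r w = w"
  proof (cases "w \<in> subtree_verts T u")
    case True
    then have "w = u"
      using u subtree_depth subtree_same_depth by (metis order_antisym)
    then show ?thesis
      using r unfolding rist_def by simp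
  next
    case False
    then show ?thesis
      using r w unfolding rist_def by simp
  qed
  then show "r \<in> rist T H w"
    using r subtree_trans[OF u] unfolding rist_def by auto
qed

text \<open>Passing from \<open>w\<close> to a child \<open>u\<close> strictly shrinks the vertex stabilizer: it fixes \<open>w\<close> by uniqueness
  of parents, and by transitivity it loses an element that moves \<open>u\<close> to a sibling. A finite group
  admits no such infinite descent.\<close>

lemma level_transitive_infinite:
  assumes two: "\<And>v. v \<in> V \<Longrightarrow> card (children T v) \<ge> 2"
    and H: "subgroup H (Aut_tree T)" and trans: "level_transitive T H"
  shows "infinite H"
proof
  assume fin: "finite H"
  interpret H: subgroup H "Aut_tree T"
    by (rule H)
  have "False" if "w \<in> V" for w
    using that
  proof (induction "card {h \<in> H. h w = w}" arbitrary: w rule: less_induct)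
    case less
    have "\<not> card (children T w) \<le> 1"
      using two less.prems by fastforce
    moreover have "finite (children T w)"
      using two[OF less.prems] card.infinite by fastforce
    ultimately obtain u u' where u: "is_child T w u" and u': "is_child T w u'" and "u \<noteq> u'"
      unfolding children_def by (metis One_nat_def card_le_Suc0_iff_eq mem_Collect_eq)
    have "u \<in> level T (Suc (depth w))" "u' \<in> level T (Suc (depth w))"
      using u u' child_verts child_depth unfolding level_def by auto
    then obtain h where h: "h \<in> H" "h u = u'"
      using trans unfolding level_transitive_def by (metis le_add1 plus_1_eq_Suc)
    have fix_parent: "k w = w" if "k \<in> H" "is_child T w (k u)" for k
    proof -
      have "is_child T (k w) (k u)"
        using Aut_child[OF _ u] that(1) by simp
      then show ?thesis
        using parent_unique that(2) by blast
    qed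
    have "{k \<in> H. k u = u} \<subset> {k \<in> H. k w = w}"
    proof
      show "{k \<in> H. k u = u} \<subseteq> {k \<in> H. k w = w}"
        using fix_parent u by auto
      have "h \<in> {k \<in> H. k w = w}" and "h \<notin> {k \<in> H. k u = u}"
        using fix_parent h u' \<open>u \<noteq> u'\<close> by simp_all
      then show "{k \<in> H. k u = u} \<noteq> {k \<in> H. k w = w}"
        by blast
    qed
    then have "card {k \<in> H. k u = u} < card {k \<in> H. k w = w}"
      using fin by (simp add: psubset_card_mono)
    then show ?case
      using less.hyps child_verts[OF u] by blast
  qed
  then show False
    using tree unfolding rooted_tree_def by blast
qed

text \<open>If all rigid stabilizers on a level were trivial, the trivial subgroup would have finite index in
  the infinite group \<open>H\<close>. Conjugation by elements of \<open>H\<close> spreads one nontrivial rigid stabilizer over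
  the whole level.\<close>

lemma branch_rist_nontrivial:
  assumes hom: "spherically_homogeneous_tree T" and br: "branch T H"
    and v: "v \<in> V" "1 \<le> depth v"
  shows "\<exists>r\<in>rist T H v. r \<noteq> \<one>\<^bsub>Aut_tree T\<^esub>"
proof -
  interpret A: group "Aut_tree T"
    by (rule group_Aut_tree)
  have H: "subgroup H (Aut_tree T)" and trans: "level_transitive T H"
    using br unfolding branch_def by blast+
  interpret H: subgroup H "Aut_tree T"
    by (rule H)
  have "\<exists>u\<in>level T (depth v). \<not> rist T H u \<subseteq> {\<one>\<^bsub>Aut_tree T\<^esub>}"
  proof (rule ccontr)
    assume "\<not> ?thesis"
    then have "(\<Union>u\<in>level T (depth v). rist T H u) \<subseteq> {\<one>\<^bsub>Aut_tree T\<^esub>}"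
      by blast
    then have "RiSt T H (depth v) \<subseteq> {\<one>\<^bsub>Aut_tree T\<^esub>}"
      unfolding RiSt_def using A.mono_generate[of _ "{\<one>\<^bsub>Aut_tree T\<^esub>}"] A.generate_one by blast
    then have "RiSt T H (depth v) = {\<one>\<^bsub>Aut_tree T\<^esub>}"
      using generate.one[of "Aut_tree T"] unfolding RiSt_def by blast
    then have "finite (rcosets\<^bsub>(Aut_tree T)\<lparr>carrier := H\<rparr>\<^esub> {\<one>\<^bsub>Aut_tree T\<^esub>})"
      using br v(2) unfolding branch_def by force
    moreover have "rcosets\<^bsub>(Aut_tree T)\<lparr>carrier := H\<rparr>\<^esub> {\<one>\<^bsub>Aut_tree T\<^esub>} = (\<lambda>h. {h}) ` H"
      using H.subset unfolding RCOSETS_def r_coset_def by auto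
    ultimately have "finite H"
      using finite_imageD[of "\<lambda>h. {h}" H] by simp
    moreover have "infinite H"
      using level_transitive_infinite[OF _ H trans] hom
      unfolding spherically_homogeneous_tree_def by blast
    ultimately show False
      by simp
  qed
  then obtain u r where u: "u \<in> level T (depth v)" and r: "r \<in> rist T H u" "r \<noteq> \<one>\<^bsub>Aut_tree T\<^esub>"
    by blast
  obtain h where h: "h \<in> H" "h u = v"
    using trans u v unfolding level_transitive_def level_def by blast
  have rH: "r \<in> H"
    using r unfolding rist_def by simp
  let ?c = "h \<otimes>\<^bsub>Aut_tree T\<^esub> r \<otimes>\<^bsub>Aut_tree T\<^esub> inv\<^bsub>Aut_tree T\<^esub> h"
  have "?c \<in> rist T H v"
    using rist_conjugate[OF H r(1) h(1)] u h unfolding level_def by simp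
  moreover have "?c \<noteq> \<one>\<^bsub>Aut_tree T\<^esub>"
  proof
    assume "?c = \<one>\<^bsub>Aut_tree T\<^esub>"
    then have "h \<otimes>\<^bsub>Aut_tree T\<^esub> r = h"
      using A.inv_solve_right'[of "\<one>\<^bsub>Aut_tree T\<^esub>" "h \<otimes>\<^bsub>Aut_tree T\<^esub> r" h] h(1) rH by simp
    then show False
      using h(1) rH r(2) by simp
  qed
  ultimately show ?thesis
    by blast
qed

text \<open>Finitely many nontrivial elements would all move something at depth at most some \<open>N\<close>. But there are
  vertices \<open>u\<close> below \<open>w\<close> deeper than \<open>N\<close>, and a nontrivial element of the rigid stabilizer of \<open>u\<close>
  moves nothing outside the subtree of \<open>u\<close>.\<close>

lemma branch_rist_infinite:
  assumes hom: "spherically_homogeneous_tree T" and br: "branch T H" and w: "w \<in> V"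
  shows "infinite (rist T H w)"
proof
  assume fin: "finite (rist T H w)"
  interpret A: group "Aut_tree T"
    by (rule group_Aut_tree)
  interpret H: subgroup H "Aut_tree T"
    using br unfolding branch_def by blast
  have moves: "\<exists>x\<in>V. r x \<noteq> x" if "r \<in> rist T H w" "r \<noteq> \<one>\<^bsub>Aut_tree T\<^esub>" for r
  proof -
    have "r \<in> carrier (Aut_tree T)"
      using that(1) unfolding rist_def by simp
    then show ?thesis
      using Aut_eqI[OF _ A.one_closed, of r] Aut_one_apply that(2) by force
  qed
  then obtain m where m: "\<And>r. r \<in> rist T H w \<Longrightarrow> r \<noteq> \<one>\<^bsub>Aut_tree T\<^esub> \<Longrightarrow> m r \<in> V \<and> r (m r) \<noteq> m r"
    by metis
  \<comment> \<open>The value of \<open>m\<close> at the identity is arbitrary; at worst it makes \<open>N\<close> larger than necessary.\<close>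
  define N where "N = Max (insert 0 ((depth \<circ> m) ` rist T H w))"
  have N: "depth (m r) \<le> N" if "r \<in> rist T H w" for r
    unfolding N_def by (rule Max_ge) (use fin that in auto)
  have "children T v \<noteq> {}" if "v \<in> V" for v
    using hom that unfolding spherically_homogeneous_tree_def by fastforce
  then obtain u where u: "u \<in> subtree_verts T w" "Suc N \<le> depth u"
    using deep_descendant[of w "Suc N"] w by blast
  then obtain r where r: "r \<in> rist T H u" "r \<noteq> \<one>\<^bsub>Aut_tree T\<^esub>"
    using branch_rist_nontrivial[OF hom br, of u] subtree_in_verts w by fastforce
  then have rw: "r \<in> rist T H w"
    using rist_mono[OF u(1) w] by blast
  then have "m r \<notin> subtree_verts T u"
    using N subtree_depth[of "m r" u] u(2) by fastforce
  then show False
    using r m[OF rw] unfolding rist_def by blast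
qed


section \<open>Trivial first returns\<close>

text \<open>The orbit of \<open>w\<close> has length exactly \<open>q\<close> and the first return to \<open>w\<close> is trivial on the subtree
  below \<open>w\<close>. For \<open>q > 0\<close> this says that \<open>w\<close> and all its descendants have orbits of the same length \<open>q\<close>.\<close>

definition trivial_return :: "nat \<Rightarrow> 'v \<Rightarrow> ('v \<Rightarrow> 'v) set" where
  "trivial_return q w = {h \<in> carrier (Aut_tree T).
     (\<forall>i. 0 < i \<and> i < q \<longrightarrow> (h ^^ i) w \<noteq> w) \<and> (\<forall>x\<in>subtree_verts T w. (h ^^ q) x = x)}"

text \<open>Orbit lengths do not decrease towards descendants, and for a torsion element they are bounded.
  Hence a vertex whose orbit is as long as possible has descendants with orbits of the same length.\<close>

lemma torsion_has_trivial_return: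
  assumes h: "h \<in> carrier (Aut_tree T)" and n: "0 < n" "\<And>x. x \<in> V \<Longrightarrow> (h ^^ n) x = x"
  obtains q w where "0 < q" and "w \<in> V" and "h \<in> trivial_return q w"
proof -
  define period where "period x = (LEAST k. 0 < k \<and> (h ^^ k) x = x)" for x
  have period: "0 < period x \<and> (h ^^ period x) x = x" if "x \<in> V" for x
    unfolding period_def by (rule LeastI[of _ n]) (simp add: n(1) n(2)[OF that])
  have period_le: "period x \<le> k" if "0 < k" "(h ^^ k) x = x" for x k
    unfolding period_def by (rule Least_le) (use that in simp)
  have "rt_root T \<in> V"
    using tree unfolding rooted_tree_def by blast
  moreover have "period x < Suc n" if "x \<in> V" for x
    using period_le[OF n(1) n(2)[OF that]] by simp
  ultimately have "\<exists>w. w \<in> V \<and> (\<forall>x. x \<in> V \<longrightarrow> period x \<le> period w)"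
    by (intro ex_has_greatest_nat[of _ "rt_root T" _ "Suc n"]) auto
  then obtain w where w: "w \<in> V" and w_max: "\<And>x. x \<in> V \<Longrightarrow> period x \<le> period w"
    by blast
  have return: "(h ^^ period w) x = x" if x: "x \<in> subtree_verts T w" for x
  proof -
    have xV: "x \<in> V"
      using subtree_in_verts x w by blast
    have "x \<in> subtree_verts T ((h ^^ period x) w)"
      using Aut_funpow(3)[OF h x, of "period x"] period[OF xV] by simp
    \<comment> \<open>Both vertices are the ancestor of \<open>x\<close> on the level of \<open>w\<close>.\<close>
    then have "(h ^^ period x) w = w"
      using subtrees_disjoint[OF _ x] Aut_funpow(2)[OF h w] by simp
    then have "period w \<le> period x"
      using period_le[of "period x" w] period[OF xV] by simp
    then show ?thesis
      using w_max[OF xV] period[OF xV] by (simp add: order_antisym)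
  qed
  have first: "(h ^^ i) w \<noteq> w" if "0 < i" "i < period w" for i
    using period_le[of i w] that by auto
  have "h \<in> trivial_return (period w) w"
    unfolding trivial_return_def mem_Collect_eq
  proof (intro conjI allI ballI impI)
    show "h \<in> carrier (Aut_tree T)"
      by (rule h)
    show "(h ^^ i) w \<noteq> w" if "0 < i \<and> i < period w" for i
      using first[of i] that by simp
    show "(h ^^ period w) x = x" if "x \<in> subtree_verts T w" for x
      using that by (rule return)
  qed
  moreover have "0 < period w"
    using period[OF w] ..
  ultimately show thesis
    using that w by blast
qed

text \<open>Start at \<open>x\<close> below \<open>w\<close> and apply \<open>r \<otimes> h\<close> repeatedly. At each of the first \<open>q - 1\<close> steps the point
  lies in the subtree of another vertex on the level of \<open>w\<close>, where \<open>r\<close> is trivial. So \<open>r\<close> acts only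
  at the return, and the first return of \<open>r \<otimes> h\<close> is that of \<open>h\<close> followed by \<open>r\<close>, namely \<open>r\<close> itself.
  It can be trivial only if \<open>r\<close> is.\<close>

lemma rist_translate_trivial_return:
  assumes "H \<subseteq> carrier (Aut_tree T)" and r: "r \<in> rist T H w" and w: "w \<in> V" and q: "0 < q"
    and h: "h \<in> trivial_return q w" and rh: "r \<otimes>\<^bsub>Aut_tree T\<^esub> h \<in> trivial_return q w"
  shows "r = \<one>\<^bsub>Aut_tree T\<^esub>"
proof -
  interpret A: group "Aut_tree T"
    by (rule group_Aut_tree)
  let ?rh = "r \<otimes>\<^bsub>Aut_tree T\<^esub> h"
  have rA: "r \<in> carrier (Aut_tree T)"
    using r assms(1) unfolding rist_def by auto
  have hA: "h \<in> carrier (Aut_tree T)"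
    using h unfolding trivial_return_def by simp
  have "r x = x" if x: "x \<in> subtree_verts T w" for x
  proof -
    have xV: "x \<in> V"
      using subtree_in_verts x w by blast
    have below: "(?rh ^^ i) x = (h ^^ i) x" if "i < q" for i
      using that
    proof (induction i)
      case (Suc i)
      let ?y = "(h ^^ Suc i) x"
      have y: "?y \<in> subtree_verts T ((h ^^ Suc i) w)"
        using Aut_funpow(3)[OF hA x] .
      have "(h ^^ Suc i) w \<noteq> w"
        using h Suc.prems unfolding trivial_return_def by blast
      then have "?y \<notin> subtree_verts T w"
        using subtrees_disjoint[OF y _ Aut_funpow(2)[OF hA w]] by blast
      then have "r ?y = ?y"
        using r Aut_funpow(1)[OF hA xV, of "Suc i"] unfolding rist_def by blast
      then show ?case
        using Suc Aut_mult_apply[OF rA hA Aut_funpow(1)[OF hA xV]] by simp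
    qed simp
    obtain k where k: "q = Suc k"
      using q gr0_implies_Suc by blast
    have "(?rh ^^ q) x = r ((h ^^ q) x)"
      using below[of k] Aut_mult_apply[OF rA hA Aut_funpow(1)[OF hA xV]] k by simp
    moreover have "(h ^^ q) x = x" and "(?rh ^^ q) x = x"
      using h rh x unfolding trivial_return_def by blast+
    ultimately show ?thesis
      by simp
  qed
  then have "r x = x" if "x \<in> V" for x
    using r that unfolding rist_def by blast
  then show ?thesis
    using Aut_eqI[OF rA A.one_closed] Aut_one_apply by simp
qed


section \<open>Evaluation at a vertex in the congruence topology\<close>

lemma openin_congruence_evaluation:
  assumes x: "x \<in> V"
  shows "openin (congruence_topology T) {h \<in> carrier (Aut_tree T). h x = y}"
proof -
  interpret A: group "Aut_tree T"
    by (rule group_Aut_tree)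
  \<comment> \<open>Basic cosets use levels from 1 on, so for the root they are taken at level 1.\<close>
  define n where "n = max 1 (depth x)"
  have coset: "openin (congruence_topology T) (g <#\<^bsub>Aut_tree T\<^esub> level_stabilizer T n)"
    if "g \<in> carrier (Aut_tree T)" for g
    unfolding congruence_topology_def
    by (rule topology_generated_by_Basis) (use that max.cobounded1[of 1 "depth x"] n_def in blast)
  have fix_x: "s x = x" if "s \<in> level_stabilizer T n" for s
  proof (cases "depth x = 0")
    case True
    then show ?thesis
      using that depth_0_imp_root[OF x] unfolding level_stabilizer_def Aut_tree_iff by simp
  next
    case False
    then show ?thesis
      using that x unfolding level_stabilizer_def level_def n_def by simp
  qed
  have "{h \<in> carrier (Aut_tree T). h x = y} =
      (\<Union>g\<in>{h \<in> carrier (Aut_tree T). h x = y}. g <#\<^bsub>Aut_tree T\<^esub> level_stabilizer T n)"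
    (is "?L = ?R")
  proof
    have "\<one>\<^bsub>Aut_tree T\<^esub> \<in> level_stabilizer T n"
      unfolding level_stabilizer_def level_def by (simp add: Aut_one_apply)
    then show "?L \<subseteq> ?R"
      unfolding l_coset_def by force
    show "?R \<subseteq> ?L"
    proof
      fix k
      assume "k \<in> ?R"
      then obtain g s where g: "g \<in> carrier (Aut_tree T)" "g x = y"
        and s: "s \<in> level_stabilizer T n" and k: "k = g \<otimes>\<^bsub>Aut_tree T\<^esub> s"
        unfolding l_coset_def by blast
      have "s \<in> carrier (Aut_tree T)"
        using s unfolding level_stabilizer_def by simp
      then show "k \<in> ?L"
        using g k fix_x[OF s] x by (simp add: Aut_mult_apply)
    qed
  qed
  moreover have "openin (congruence_topology T) ?R"
    by (rule openin_Union) (use coset in auto)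
  ultimately show ?thesis
    by simp
qed

end


section \<open>Topological groups and Haar measure\<close>

lemma topological_groupD:
  assumes "topological_group G X"
  shows "group G" and "topspace X = carrier G"
    and "continuous_map (prod_topology X X) X (\<lambda>(x, y). x \<otimes>\<^bsub>G\<^esub> y)"
  using assms unfolding topological_group_def by auto

lemma continuous_map_mult:
  assumes G: "topological_group G X" and "continuous_map Y X f" and "continuous_map Y X g"
  shows "continuous_map Y X (\<lambda>y. f y \<otimes>\<^bsub>G\<^esub> g y)"
  using continuous_map_compose[OF continuous_map_pairedI[OF assms(2,3)] topological_groupD(3)[OF G]]
  by (simp add: o_def)

lemma continuous_map_group_pow:
  assumes G: "topological_group G X"
  shows "continuous_map X X (\<lambda>g. g [^]\<^bsub>G\<^esub> (n::nat))"
proof (induction n)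
  case 0
  interpret group G
    using topological_groupD(1)[OF G] .
  show ?case
    using topological_groupD(2)[OF G] by simp
next
  case (Suc n)
  have "continuous_map X X (\<lambda>g. g [^]\<^bsub>G\<^esub> n \<otimes>\<^bsub>G\<^esub> g)"
    by (rule continuous_map_mult[OF G Suc]) simp
  then show ?case
    by simp
qed

text \<open>Translates are closed as preimages under the translation by the inverse. This makes them
  measurable for the Haar measure.\<close>

lemma closedin_l_coset:
  assumes G: "topological_group G X" and A: "closedin X A" and g: "g \<in> carrier G"
  shows "closedin X (g <#\<^bsub>G\<^esub> A)"
proof -
  interpret group G
    using topological_groupD(1)[OF G] .
  have top: "topspace X = carrier G"
    using topological_groupD(2)[OF G] .
  have "continuous_map X X (\<lambda>x. inv\<^bsub>G\<^esub> g \<otimes>\<^bsub>G\<^esub> x)"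
    by (rule continuous_map_mult[OF G]) (use g top in auto)
  then have "closedin X {x \<in> topspace X. inv\<^bsub>G\<^esub> g \<otimes>\<^bsub>G\<^esub> x \<in> A}"
    using A by (rule closedin_continuous_map_preimage)
  moreover have "{x \<in> topspace X. inv\<^bsub>G\<^esub> g \<otimes>\<^bsub>G\<^esub> x \<in> A} = g <#\<^bsub>G\<^esub> A"
  proof
    have AG: "A \<subseteq> carrier G"
      using closedin_subset[OF A] top by simp
    show "{x \<in> topspace X. inv\<^bsub>G\<^esub> g \<otimes>\<^bsub>G\<^esub> x \<in> A} \<subseteq> g <#\<^bsub>G\<^esub> A"
    proof
      fix x
      assume "x \<in> {x \<in> topspace X. inv\<^bsub>G\<^esub> g \<otimes>\<^bsub>G\<^esub> x \<in> A}"
      then have "inv\<^bsub>G\<^esub> g \<otimes>\<^bsub>G\<^esub> x \<in> A" and "x = g \<otimes>\<^bsub>G\<^esub> (inv\<^bsub>G\<^esub> g \<otimes>\<^bsub>G\<^esub> x)"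
        using g top by (simp_all add: m_assoc[symmetric])
      then show "x \<in> g <#\<^bsub>G\<^esub> A"
        unfolding l_coset_def by blast
    qed
    show "g <#\<^bsub>G\<^esub> A \<subseteq> {x \<in> topspace X. inv\<^bsub>G\<^esub> g \<otimes>\<^bsub>G\<^esub> x \<in> A}"
      using g AG top unfolding l_coset_def by (auto simp: m_assoc[symmetric])
  qed
  ultimately show ?thesis
    by simp
qed

lemma pro_p_group_Hausdorff:
  assumes "pro_p_group TYPE('i \<times> 'b) p G X"
  shows "Hausdorff_space X"
proof -
  obtain I rel and K :: "'i \<Rightarrow> 'b monoid" and f \<psi>
    where "homeomorphic_map X (inverse_limit_topology I rel K f) \<psi>"
    using assms unfolding pro_p_group_def by blast
  moreover have "Hausdorff_space (inverse_limit_topology I rel K f)"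
    unfolding inverse_limit_topology_def
    by (intro Hausdorff_space_subtopology) (simp add: Hausdorff_space_product_topology)
  ultimately show ?thesis
    using homeomorphic_Hausdorff_space[OF homeomorphic_map_imp_homeomorphic_space] by blast
qed

text \<open>The union of these sets over \<open>n > 0\<close> is the torsion set, which is thus an \<open>F\<^sub>\<sigma>\<close> and measurable.\<close>

lemma closedin_torsion_exponent:
  assumes G: "topological_group G X" and X: "Hausdorff_space X"
  shows "closedin X {g \<in> carrier G. g [^]\<^bsub>G\<^esub> (n::nat) = \<one>\<^bsub>G\<^esub>}"
proof -
  interpret group G
    using topological_groupD(1)[OF G] .
  have "closedin X {\<one>\<^bsub>G\<^esub>}"
    using X topological_groupD(2)[OF G] by (simp add: closedin_Hausdorff_sing_eq)
  then have "closedin X {g \<in> topspace X. g [^]\<^bsub>G\<^esub> n \<in> {\<one>\<^bsub>G\<^esub>}}"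
    by (rule closedin_continuous_map_preimage[OF continuous_map_group_pow[OF G]])
  then show ?thesis
    using topological_groupD(2)[OF G] by simp
qed

lemma haar_closed_in_sets:
  assumes "normalized_haar_measure G X \<mu>" and A: "closedin X A"
  shows "A \<in> sets \<mu>"
proof -
  have "topspace X - (topspace X - A) \<in> sigma_sets (topspace X) {U. openin X U}"
    using A by (intro sigma_sets.Compl sigma_sets.Basic) auto
  moreover have "topspace X - (topspace X - A) = A"
    using closedin_subset[OF A] by blast
  ultimately show ?thesis
    using assms(1) unfolding normalized_haar_measure_def by simp
qed

text \<open>Infinitely many disjoint sets of the same measure fit into a probability space only if that measure
  is 0.\<close>

lemma haar_null_if_disjoint_translates:
  assumes haar: "normalized_haar_measure G X \<mu>" and A: "A \<in> sets \<mu>"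
    and S: "infinite S" "S \<subseteq> carrier G"
    and sets: "\<And>g. g \<in> S \<Longrightarrow> g <#\<^bsub>G\<^esub> A \<in> sets \<mu>"
    and disj: "disjoint_family_on (\<lambda>g. g <#\<^bsub>G\<^esub> A) S"
  shows "A \<in> null_sets \<mu>"
proof -
  interpret prob_space \<mu>
    using haar unfolding normalized_haar_measure_def by blast
  obtain s :: "nat \<Rightarrow> _" where s: "inj s" "range s \<subseteq> S"
    using infinite_countable_subset[OF S(1)] by blast
  have sS: "s i \<in> S" for i
    using s(2) by blast
  have "disjoint_family (\<lambda>i. s i <#\<^bsub>G\<^esub> A)"
    unfolding disjoint_family_on_def
  proof (intro ballI impI)
    fix i j :: nat
    assume "i \<noteq> j"
    then have "s i \<noteq> s j"
      using s(1) by (simp add: inj_eq)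
    then show "(s i <#\<^bsub>G\<^esub> A) \<inter> (s j <#\<^bsub>G\<^esub> A) = {}"
      using disjoint_family_onD[OF disj sS sS] by simp
  qed
  then have "(\<lambda>i. prob (s i <#\<^bsub>G\<^esub> A)) sums prob (\<Union>i. s i <#\<^bsub>G\<^esub> A)"
    using sets sS by (intro finite_measure_UNION) auto
  moreover have "prob (s i <#\<^bsub>G\<^esub> A) = prob A" for i
  proof -
    have "s i \<in> carrier G"
      using sS S(2) by blast
    then have "emeasure \<mu> (s i <#\<^bsub>G\<^esub> A) = emeasure \<mu> A"
      using haar A unfolding normalized_haar_measure_def by blast
    then show ?thesis
      by (simp add: measure_def)
  qed
  ultimately have "summable (\<lambda>i::nat. prob A)"
    using sums_summable by simp
  then have "prob A = 0"
    by (simp add: summable_const_iff)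
  then show ?thesis
    using A by (simp add: null_sets_def emeasure_eq_measure)
qed


section \<open>Torsion in groups with a branch quotient\<close>

context rooted_tree_graph
begin

lemma pullback_evaluation:
  assumes cont: "continuous_map X (subtopology (congruence_topology T) H) \<phi>"
    and H: "H \<subseteq> carrier (Aut_tree T)" and x: "x \<in> V"
  shows "openin X {g \<in> topspace X. \<phi> g x = y}" and "closedin X {g \<in> topspace X. \<phi> g x = y}"
proof -
  have eval: "openin X {g \<in> topspace X. \<phi> g x = z}" for z
  proof -
    have "openin (congruence_topology T) {h \<in> carrier (Aut_tree T). h x = z}"
      by (rule openin_congruence_evaluation[OF x])
    moreover have "continuous_map X (congruence_topology T) \<phi>"
      using cont by (simp add: continuous_map_in_subtopology)
    ultimately have "openin X {g \<in> topspace X. \<phi> g \<in> {h \<in> carrier (Aut_tree T). h x = z}}"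
      by (rule openin_continuous_map_preimage[rotated])
    moreover have "\<phi> g \<in> carrier (Aut_tree T)" if "g \<in> topspace X" for g
      using cont H that by (auto simp: continuous_map_in_subtopology)
    then have "{g \<in> topspace X. \<phi> g \<in> {h \<in> carrier (Aut_tree T). h x = z}} = {g \<in> topspace X. \<phi> g x = z}"
      by auto
    ultimately show ?thesis
      by simp
  qed
  show "openin X {g \<in> topspace X. \<phi> g x = y}"
    by (rule eval)
  have "topspace X - {g \<in> topspace X. \<phi> g x = y} = (\<Union>z\<in>- {y}. {g \<in> topspace X. \<phi> g x = z})"
    by auto
  moreover have "openin X (\<Union>z\<in>- {y}. {g \<in> topspace X. \<phi> g x = z})"
    using eval by blast
  ultimately show "closedin X {g \<in> topspace X. \<phi> g x = y}"
    unfolding closedin_def by auto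
qed

text \<open>The defining conditions ask powers of an automorphism to fix or move given vertices. Each such
  condition is clopen, but the subtree below \<open>w\<close> imposes infinitely many of them.\<close>

lemma closedin_pullback_trivial_return:
  assumes G: "topological_group G X" and H: "subgroup H (Aut_tree T)"
    and hom: "\<phi> \<in> hom G ((Aut_tree T)\<lparr>carrier := H\<rparr>)"
    and cont: "continuous_map X (subtopology (congruence_topology T) H) \<phi>" and w: "w \<in> V"
  shows "closedin X {g \<in> carrier G. \<phi> g \<in> trivial_return q w}"
proof -
  interpret A: group "Aut_tree T"
    by (rule group_Aut_tree)
  interpret H: subgroup H "Aut_tree T"
    by (rule H)
  note grp = topological_groupD(1)[OF G] and top = topological_groupD(2)[OF G]
  have \<phi>A: "\<phi> g \<in> carrier (Aut_tree T)" if "g \<in> carrier G" for g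
    using hom that H.subset unfolding hom_def by auto
  have pow: "\<phi> (g [^]\<^bsub>G\<^esub> n) x = (\<phi> g ^^ n) x" if "g \<in> carrier G" "x \<in> V" for g n x
  proof -
    have "\<phi> (g [^]\<^bsub>G\<^esub> n) = \<phi> g [^]\<^bsub>(Aut_tree T)\<lparr>carrier := H\<rparr>\<^esub> n"
      using hom_nat_pow[OF hom that(1) grp] H.subgroup_is_group[OF A.is_group] by blast
    also have "\<dots> = \<phi> g [^]\<^bsub>Aut_tree T\<^esub> n"
      by (rule A.nat_pow_consistent[symmetric])
    finally show ?thesis
      using Aut_pow_apply[OF \<phi>A that(2)] that(1) by simp
  qed
  let ?F = "\<lambda>n x. {g \<in> carrier G. (\<phi> g ^^ n) x = x}"
  have F_eq: "?F n x = {g \<in> topspace X. g [^]\<^bsub>G\<^esub> n \<in> {g \<in> topspace X. \<phi> g x = x}}" if "x \<in> V" for n x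
    using pow that top monoid.nat_pow_closed[OF group.is_monoid[OF grp]] by auto
  have clopen: "openin X (?F n x) \<and> closedin X (?F n x)" if "x \<in> V" for n x
    unfolding F_eq[OF that]
    using openin_continuous_map_preimage[OF continuous_map_group_pow[OF G]
        pullback_evaluation(1)[OF cont H.subset that]]
      closedin_continuous_map_preimage[OF continuous_map_group_pow[OF G]
        pullback_evaluation(2)[OF cont H.subset that]] by blast
  have "topspace X - {g \<in> carrier G. \<phi> g \<in> trivial_return q w} =
      (\<Union>i\<in>{0<..<q}. ?F i w) \<union> (\<Union>x\<in>subtree_verts T w. topspace X - ?F q x)"
    using \<phi>A top unfolding trivial_return_def by auto
  moreover have "openin X ((\<Union>i\<in>{0<..<q}. ?F i w) \<union> (\<Union>x\<in>subtree_verts T w. topspace X - ?F q x))"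
    using clopen w subtree_in_verts by (intro openin_Un openin_Union) auto
  ultimately show ?thesis
    using top unfolding closedin_def by auto
qed

end

theorem corollary2:
  fixes p :: nat
    and G :: "('a, 'm) monoid_scheme" and X :: "'a topology"
    and T :: "'v rooted_graph" and H :: "('v \<Rightarrow> 'v) set"
    and \<phi> :: "'a \<Rightarrow> 'v \<Rightarrow> 'v"
    and \<mu> :: "'a measure"
  assumes "prime p"
    and "pro_p_group TYPE('i \<times> 'b) p G X"
    and "spherically_homogeneous_tree T"
    and "subgroup H (Aut_tree T)"
    and "closedin (congruence_topology T) H"
    and "branch T H"
    and "pro_p_group TYPE('j \<times> 'c) p ((Aut_tree T)\<lparr>carrier := H\<rparr>)
           (subtopology (congruence_topology T) H)"
    and "\<phi> \<in> hom G ((Aut_tree T)\<lparr>carrier := H\<rparr>)"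
    and "continuous_map X (subtopology (congruence_topology T) H) \<phi>"
    and "\<phi> ` carrier G = H"
    and "normalized_haar_measure G X \<mu>"
  shows "torsion_elements G \<in> null_sets \<mu>"
proof -
  note pro_p = assms(2) and sph = assms(3) and H = assms(4) and br = assms(6)
    and hom = assms(8) and cont = assms(9) and surj = assms(10) and haar = assms(11)
  have G: "topological_group G X"
    using pro_p unfolding pro_p_group_def by blast
  have Hausdorff: "Hausdorff_space X"
    using pro_p by (rule pro_p_group_Hausdorff)
  interpret rooted_tree_graph T
    using sph unfolding spherically_homogeneous_tree_def by unfold_locales blast
  interpret A: group "Aut_tree T"
    by (rule group_Aut_tree)
  interpret H: subgroup H "Aut_tree T"
    by (rule H)
  interpret G: group G
    using topological_groupD(1)[OF G] .
  interpret \<phi>: group_hom G "(Aut_tree T)\<lparr>carrier := H\<rparr>" \<phi>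
    using hom H.subgroup_is_group[OF A.is_group] G.is_group
    by (simp add: group_hom_def group_hom_axioms_def)
  have \<phi>_mult: "\<phi> (x \<otimes>\<^bsub>G\<^esub> y) = \<phi> x \<otimes>\<^bsub>Aut_tree T\<^esub> \<phi> y" if "x \<in> carrier G" "y \<in> carrier G" for x y
    using \<phi>.hom_mult[OF that] by simp

  let ?E = "\<lambda>q w. {g \<in> carrier G. \<phi> g \<in> trivial_return q w}"
  have E_closed: "closedin X (?E q w)" if "w \<in> V" for q w
    using closedin_pullback_trivial_return[OF G H hom cont that] .
  have E_null: "?E q w \<in> null_sets \<mu>" if q: "0 < q" and w: "w \<in> V" for q w
  proof -
    \<comment> \<open>The rigid stabilizer lies in \<open>H\<close>, whereas the translates are to be formed in \<open>G\<close>.\<close>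
    define lift where "lift r = (SOME g. g \<in> carrier G \<and> \<phi> g = r)" for r
    have lift: "lift r \<in> carrier G \<and> \<phi> (lift r) = r" if "r \<in> rist T H w" for r
      unfolding lift_def by (rule someI_ex) (use that surj in \<open>auto simp: rist_def\<close>)
    interpret R: subgroup "rist T H w" "Aut_tree T"
      by (rule rist_subgroup[OF H w])
    show ?thesis
    proof (rule haar_null_if_disjoint_translates[OF haar])
      show "?E q w \<in> sets \<mu>"
        using haar_closed_in_sets[OF haar E_closed[OF w]] .
      have "inj_on lift (rist T H w)"
        using lift by (metis inj_onI)
      then show "infinite (lift ` rist T H w)"
        using branch_rist_infinite[OF sph br w] by (simp add: finite_image_iff)
      show "lift ` rist T H w \<subseteq> carrier G"
        using lift by blast
      show "g <#\<^bsub>G\<^esub> ?E q w \<in> sets \<mu>" if "g \<in> lift ` rist T H w" for g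
        using haar_closed_in_sets[OF haar closedin_l_coset[OF G E_closed[OF w]]] lift that by blast
      have "r = s"
        if r: "r \<in> rist T H w" and s: "s \<in> rist T H w"
          and x: "x \<in> lift r <#\<^bsub>G\<^esub> ?E q w" "x \<in> lift s <#\<^bsub>G\<^esub> ?E q w" for r s x
      proof -
        obtain e where e: "e \<in> ?E q w" "x = lift r \<otimes>\<^bsub>G\<^esub> e"
          using x(1) unfolding l_coset_def by blast
        obtain d where d: "d \<in> ?E q w" "x = lift s \<otimes>\<^bsub>G\<^esub> d"
          using x(2) unfolding l_coset_def by blast
        have eA: "\<phi> e \<in> carrier (Aut_tree T)" and dA: "\<phi> d \<in> carrier (Aut_tree T)"
          using e(1) d(1) unfolding trivial_return_def by blast+
        let ?t = "inv\<^bsub>Aut_tree T\<^esub> s \<otimes>\<^bsub>Aut_tree T\<^esub> r"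
        have "r \<otimes>\<^bsub>Aut_tree T\<^esub> \<phi> e = s \<otimes>\<^bsub>Aut_tree T\<^esub> \<phi> d"
        proof -
          have "\<phi> x = r \<otimes>\<^bsub>Aut_tree T\<^esub> \<phi> e"
            using \<phi>_mult[of "lift r" e] lift[OF r] e by simp
          moreover have "\<phi> x = s \<otimes>\<^bsub>Aut_tree T\<^esub> \<phi> d"
            using \<phi>_mult[of "lift s" d] lift[OF s] d by simp
          ultimately show ?thesis
            by simp
        qed
        then have "\<phi> d = inv\<^bsub>Aut_tree T\<^esub> s \<otimes>\<^bsub>Aut_tree T\<^esub> (r \<otimes>\<^bsub>Aut_tree T\<^esub> \<phi> e)"
          using A.inv_solve_left[OF dA R.mem_carrier[OF s], of "r \<otimes>\<^bsub>Aut_tree T\<^esub> \<phi> e"]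
            A.m_closed[OF R.mem_carrier[OF r] eA] by blast
        then have "?t \<otimes>\<^bsub>Aut_tree T\<^esub> \<phi> e \<in> trivial_return q w"
          using d(1) r s eA by (simp add: A.m_assoc)
        moreover have "?t \<in> rist T H w"
          using r s by simp
        ultimately have "?t = \<one>\<^bsub>Aut_tree T\<^esub>"
          using rist_translate_trivial_return[OF H.subset _ w q] e(1) by blast
        then show ?thesis
          using A.inv_solve_left'[of "\<one>\<^bsub>Aut_tree T\<^esub>" s r] r s by simp
      qed
      then show "disjoint_family_on (\<lambda>g. g <#\<^bsub>G\<^esub> ?E q w) (lift ` rist T H w)"
        unfolding disjoint_family_on_def by blast
    qed
  qed

  have "countable ({0<..} \<times> V :: (nat \<times> 'v) set)"
    using sph countable_verts unfolding spherically_homogeneous_tree_def by simp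
  then have "(\<Union>(q, w)\<in>{0<..} \<times> V. ?E q w) \<in> null_sets \<mu>"
    using E_null by (intro null_sets_UN') auto
  moreover have "torsion_elements G \<subseteq> (\<Union>(q, w)\<in>{0<..} \<times> V. ?E q w)"
  proof
    fix g
    assume "g \<in> torsion_elements G"
    then obtain n :: nat where g: "g \<in> carrier G" and n: "0 < n" "g [^]\<^bsub>G\<^esub> n = \<one>\<^bsub>G\<^esub>"
      unfolding torsion_elements_def by blast
    have \<phi>g: "\<phi> g \<in> carrier (Aut_tree T)"
      using \<phi>.hom_closed[OF g] by simp
    have "\<phi> g [^]\<^bsub>Aut_tree T\<^esub> n = \<one>\<^bsub>Aut_tree T\<^esub>"
      using \<phi>.hom_nat_pow[OF g, of n] \<phi>.hom_one n by (simp add: A.nat_pow_consistent)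
    then have "(\<phi> g ^^ n) x = x" if "x \<in> V" for x
      using Aut_pow_apply[OF \<phi>g that, of n] Aut_one_apply[OF that] by simp
    then obtain q w where "0 < q" "w \<in> V" "\<phi> g \<in> trivial_return q w"
      using torsion_has_trivial_return[OF \<phi>g n(1)] by blast
    then show "g \<in> (\<Union>(q, w)\<in>{0<..} \<times> V. ?E q w)"
      using g by auto
  qed
  moreover have "torsion_elements G \<in> sets \<mu>"
  proof -
    have "torsion_elements G = (\<Union>n\<in>{0<..}. {g \<in> carrier G. g [^]\<^bsub>G\<^esub> (n::nat) = \<one>\<^bsub>G\<^esub>})"
      unfolding torsion_elements_def by auto
    moreover have "{g \<in> carrier G. g [^]\<^bsub>G\<^esub> (n::nat) = \<one>\<^bsub>G\<^esub>} \<in> sets \<mu>" for n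
      using haar_closed_in_sets[OF haar closedin_torsion_exponent[OF G Hausdorff]] .
    ultimately show ?thesis
      by simp
  qed
  ultimately show ?thesis
    using null_sets_subset by blast
qed

end
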